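(* Let $p$ be a prime and let $u$ be a fixed point of a profinite substitution $\theta=\varprojlim\theta_\alpha$. If $\theta_\alpha$ is length-$p$ and primitive for each $\alpha\ge0$, then $(X_u,\sigma)$ is minimal.
   Context: $\Sigma_p=\{0,\dots,p-1\}$. An inverse family of finite automata is a sequence $(\mathcal M_\alpha)_{\alpha\ge0}=(\mathcal S_\alpha,\Sigma_p,\delta_\alpha,\overline s_\alpha,\mathbb Z/(p^\alpha\mathbb Z),\tau_\alpha)_{\alpha\ge0}$ where $\mathcal S_\alpha$ is a finite set of states, $\overline s_\alpha\in\mathcal S_\alpha$ the initial state, $\delta_\alpha:\mathcal S_\alpha\times\Sigma_p\to\mathcal S_\alpha$ the transition function, $\tau_\alpha:\mathcal S_\alpha\to\mathbb Z/(p^\alpha\mathbb Z)$ the output function, together with maps $\psi_{\alpha,\beta}:\mathcal S_\beta\to\mathcal S_\alpha$ ($0\le\alpha\le\beta$) satisfying $\psi_{\alpha,\beta}(\overline s_\beta)=\overline s_\alpha$, $\psi_{\alpha,\beta}(\delta_\beta(s,i))=\delta_\alpha(\psi_{\alpha,\beta}(s),i)$, $\tau_\beta(s)\bmod p^\alpha=\tau_\alpha(\psi_{\alpha,\beta}(s))$ and $\psi_{\alpha,\gamma}=\psi_{\alpha,\beta}\circ\psi_{\beta,\gamma}$ for $\alpha\le\beta\le\gamma$. The automaton $\mathcal M_\alpha$ (with $\delta_\alpha(\overline s_\alpha,0)=\overline s_\alpha$) defines the length-$p$ substitution $\theta_\alpha$ on $\mathcal S_\alpha$, $\theta_\alpha(s)=\delta_\alpha(s,0)\delta_\alpha(s,1)\cdots\delta_\alpha(s,p-1)$.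 Let $\mathcal S=\varprojlim\mathcal S_\alpha=\{(s_\alpha)_\alpha\in\prod_\alpha\mathcal S_\alpha:\psi_{\alpha,\beta}(s_\beta)=s_\alpha\text{ for all }\alpha\le\beta\}$ with the inverse limit topology (each $\mathcal S_\alpha$ discrete). The profinite substitution $\theta=\varprojlim\theta_\alpha$ is the length-$p$ substitution $\theta:\mathcal S\to\mathcal S^p$ whose $i$-th letter is $\theta(s)_i=\varprojlim\theta_\alpha(s_\alpha)_i$, i.e. $(\theta(s)_i)_\alpha=\delta_\alpha(s_\alpha,i)$, for $0\le i\le p-1$. It extends to $\mathcal S^{\mathbb N}$ by concatenation, and a fixed point is $u\in\mathcal S^{\mathbb N}$ with $\theta(u)=u$. $\mathcal S^{\mathbb N}$ has the product topology, $\sigma$ is the shift $(x(n))_{n\geq 0}\mapsto(x(n+1))_{n\geq 0}$, and $X_u$ is the closure of $\{\sigma^n(u):n\in\mathbb N\}$. A substitution $\theta$ on a finite alphabet $\mathcal A$ is primitive if there is $k\in\mathbb N$ such that for all $a,a'\in\mathcal A$ the word $\theta^k(a)$ contains $a'$. $(X_u,\sigma)$ is minimal if $X_u$ is the $\sigma$-orbit closure of every point of $X_u$. *)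

theory Defs
  imports "HOL-Analysis.Analysis" "HOL-Computational_Algebra.Primes"
begin

section \<open>Substitutions\<close>

text \<open>A substitution maps letters to words. All notions are relative to an alphabet given as
  a set, since the alphabets below vary with a natural number.\<close>

definition subst_word :: "('a \<Rightarrow> 'a list) \<Rightarrow> 'a list \<Rightarrow> 'a list" where
  "subst_word \<theta> w = concat (map \<theta> w)"

definition length_substitution :: "nat \<Rightarrow> 'a set \<Rightarrow> ('a \<Rightarrow> 'a list) \<Rightarrow> bool" where
  "length_substitution p A \<theta> \<longleftrightarrow> (\<forall>a\<in>A. length (\<theta> a) = p \<and> set (\<theta> a) \<subseteq> A)"

definition primitive_substitution :: "'a set \<Rightarrow> ('a \<Rightarrow> 'a list) \<Rightarrow> bool" where
  "primitive_substitution A \<theta> \<longleftrightarrow>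
     (\<exists>k. \<forall>a\<in>A. \<forall>a'\<in>A. a' \<in> set ((subst_word \<theta> ^^ k) [a]))"

text \<open>Extension of a length-\<open>p\<close> substitution to one-sided sequences by concatenation: the
  \<open>n\<close>-th block of length \<open>p\<close> of the image of \<open>x\<close> is the word \<open>\<theta> (x n)\<close>.\<close>

definition subst_seq :: "nat \<Rightarrow> ('a \<Rightarrow> 'a list) \<Rightarrow> (nat \<Rightarrow> 'a) \<Rightarrow> (nat \<Rightarrow> 'a)" where
  "subst_seq p \<theta> x = (\<lambda>m. \<theta> (x (m div p)) ! (m mod p))"

lemma subst_seq_prefix:
  assumes "\<And>n. length (\<theta> (x n)) = p"
  shows "map (subst_seq p \<theta> x) [0..<n * p] = subst_word \<theta> (map x [0..<n])"
proof (induction n)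
  case 0
  show ?case by (simp add: subst_word_def)
next
  case (Suc n)
  have "map (subst_seq p \<theta> x) [n * p..<n * p + p] = \<theta> (x n)"
    by (rule nth_equalityI) (use assms in \<open>auto simp: subst_seq_def\<close>)
  moreover have "[0..<Suc n * p] = [0..<n * p] @ [n * p..<n * p + p]"
    by (metis add.commute le0 mult_Suc upt_add_eq_append)
  ultimately show ?case using Suc by (simp add: subst_word_def)
qed

section \<open>Inverse families of automata\<close>

text \<open>The state sets \<open>S \<alpha>\<close> are subsets of one type; this is no restriction, as
  countably many finite sets can always be embedded in a common type. The input alphabet is
  \<open>{..<p}\<close>, and \<open>\<int>/(p^\<alpha>\<int>)\<close> is represented by the residues \<open>{0..<p^\<alpha>}\<close>.
  The map \<open>\<psi> \<alpha> \<beta>\<close> goes from level \<open>\<beta>\<close> to level \<open>\<alpha>\<close>.\<close>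

locale inverse_family =
  fixes p :: nat
    and S :: "nat \<Rightarrow> 's set"
    and \<delta> :: "nat \<Rightarrow> 's \<Rightarrow> nat \<Rightarrow> 's"
    and init :: "nat \<Rightarrow> 's"
    and \<tau> :: "nat \<Rightarrow> 's \<Rightarrow> int"
    and \<psi> :: "nat \<Rightarrow> nat \<Rightarrow> 's \<Rightarrow> 's"
  assumes finite_states: "finite (S \<alpha>)"
    and init_state: "init \<alpha> \<in> S \<alpha>"
    and transition_state: "s \<in> S \<alpha> \<Longrightarrow> i < p \<Longrightarrow> \<delta> \<alpha> s i \<in> S \<alpha>"
    and output_residue: "s \<in> S \<alpha> \<Longrightarrow> \<tau> \<alpha> s \<in> {0..<int p ^ \<alpha>}"
    and init_loop: "\<delta> \<alpha> (init \<alpha>) 0 = init \<alpha>"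
    and proj_state: "\<alpha> \<le> \<beta> \<Longrightarrow> s \<in> S \<beta> \<Longrightarrow> \<psi> \<alpha> \<beta> s \<in> S \<alpha>"
    and proj_init: "\<alpha> \<le> \<beta> \<Longrightarrow> \<psi> \<alpha> \<beta> (init \<beta>) = init \<alpha>"
    and proj_transition: "\<alpha> \<le> \<beta> \<Longrightarrow> s \<in> S \<beta> \<Longrightarrow> i < p \<Longrightarrow>
          \<psi> \<alpha> \<beta> (\<delta> \<beta> s i) = \<delta> \<alpha> (\<psi> \<alpha> \<beta> s) i"
    and proj_output: "\<alpha> \<le> \<beta> \<Longrightarrow> s \<in> S \<beta> \<Longrightarrow>
          \<tau> \<beta> s mod int p ^ \<alpha> = \<tau> \<alpha> (\<psi> \<alpha> \<beta> s)"
    and proj_comp: "\<alpha> \<le> \<beta> \<Longrightarrow> \<beta> \<le> \<gamma> \<Longrightarrow> s \<in> S \<gamma> \<Longrightarrow>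
          \<psi> \<alpha> \<gamma> s = \<psi> \<alpha> \<beta> (\<psi> \<beta> \<gamma> s)"

definition level_subst :: "nat \<Rightarrow> (nat \<Rightarrow> 's \<Rightarrow> nat \<Rightarrow> 's) \<Rightarrow> nat \<Rightarrow> 's \<Rightarrow> 's list" where
  "level_subst p \<delta> \<alpha> s = map (\<delta> \<alpha> s) [0..<p]"

section \<open>Inverse limit and profinite substitution\<close>

definition inverse_limit :: "(nat \<Rightarrow> 's set) \<Rightarrow> (nat \<Rightarrow> nat \<Rightarrow> 's \<Rightarrow> 's) \<Rightarrow> (nat \<Rightarrow> 's) set" where
  "inverse_limit S \<psi> =
     {s. (\<forall>\<alpha>. s \<alpha> \<in> S \<alpha>) \<and> (\<forall>\<alpha> \<beta>. \<alpha> \<le> \<beta> \<longrightarrow> \<psi> \<alpha> \<beta> (s \<beta>) = s \<alpha>)}"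

definition inverse_limit_topology ::
    "(nat \<Rightarrow> 's set) \<Rightarrow> (nat \<Rightarrow> nat \<Rightarrow> 's \<Rightarrow> 's) \<Rightarrow> (nat \<Rightarrow> 's) topology" where
  "inverse_limit_topology S \<psi> =
     subtopology (product_topology (\<lambda>\<alpha>. discrete_topology (S \<alpha>)) UNIV) (inverse_limit S \<psi>)"

lemma topspace_inverse_limit_topology [simp]:
  "topspace (inverse_limit_topology S \<psi>) = inverse_limit S \<psi>"
  by (auto simp: inverse_limit_topology_def inverse_limit_def)

definition profinite_subst ::
    "nat \<Rightarrow> (nat \<Rightarrow> 's \<Rightarrow> nat \<Rightarrow> 's) \<Rightarrow> (nat \<Rightarrow> 's) \<Rightarrow> (nat \<Rightarrow> 's) list" where
  "profinite_subst p \<delta> s = map (\<lambda>i. \<lambda>\<alpha>. level_subst p \<delta> \<alpha> (s \<alpha>) ! i) [0..<p]"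

section \<open>Shift dynamics\<close>

text \<open>One-sided sequences over the topological space \<open>T\<close>, with the product topology.\<close>

definition seq_topology :: "'a topology \<Rightarrow> (nat \<Rightarrow> 'a) topology" where
  "seq_topology T = product_topology (\<lambda>_. T) UNIV"

lemma topspace_seq_topology: "topspace (seq_topology T) = {x. \<forall>n. x n \<in> topspace T}"
  by (auto simp: seq_topology_def)

definition shift :: "(nat \<Rightarrow> 'a) \<Rightarrow> (nat \<Rightarrow> 'a)" where
  "shift x = (\<lambda>n. x (Suc n))"

definition orbit_closure :: "'a topology \<Rightarrow> (nat \<Rightarrow> 'a) \<Rightarrow> (nat \<Rightarrow> 'a) set" where
  "orbit_closure T x = seq_topology T closure_of {(shift ^^ n) x |n. True}"

definition minimal_shift :: "'a topology \<Rightarrow> (nat \<Rightarrow> 'a) set \<Rightarrow> bool" where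
  "minimal_shift T X \<longleftrightarrow> (\<forall>x\<in>X. X = orbit_closure T x)"

end

theory Submission imports Defs begin

text \<open>Let \<open>u\<^sub>\<alpha>\<close> be the image of \<open>u\<close> over the finite alphabet at level \<open>\<alpha>\<close>; it is a fixed point of
  \<open>\<theta>\<^sub>\<alpha>\<close>. By primitivity the letter \<open>u\<^sub>\<alpha>(0)\<close> occurs in every block \<open>\<theta>\<^sub>\<alpha>\<^sup>k(u\<^sub>\<alpha>(n))\<close>, so the prefix
  \<open>\<theta>\<^sub>\<alpha>\<^sup>r(u\<^sub>\<alpha>(0))\<close>, whose length \<open>p\<^sup>r\<close> is arbitrarily large, occurs in \<open>u\<^sub>\<alpha>\<close> with bounded gaps.
  Convergence in the inverse limit is tested on one level and finitely many coordinates at a time,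
  so this uniform recurrence at each level gives minimality.\<close>

section \<open>Fixed points of primitive substitutions of constant length\<close>

lemma subst_word_append: "subst_word \<theta> (v @ w) = subst_word \<theta> v @ subst_word \<theta> w"
  by (simp add: subst_word_def)

text \<open>A block is what remains of a prefix after a shorter prefix is removed. Both prefixes are
  mapped correctly by \<open>subst_seq_prefix\<close>, and the common initial word cancels.\<close>

lemma subst_word_block:
  assumes "\<And>n. length (\<theta> (v n)) = p" and "subst_seq p \<theta> v = v" and "a \<le> b"
  shows "subst_word \<theta> (map v [a..<b]) = map v [a * p..<b * p]"
proof -
  have prefix: "subst_word \<theta> (map v [0..<n]) = map v [0..<n * p]" for n
    using subst_seq_prefix[of \<theta> v p n] assms(1,2) by simp
  have "[0..<b] = [0..<a] @ [a..<b]" "[0..<b * p] = [0..<a * p] @ [a * p..<b * p]"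
    using \<open>a \<le> b\<close> upt_add_eq_append[of 0 a "b - a"] upt_add_eq_append[of 0 "a * p" "b * p - a * p"]
    by simp_all
  then have "subst_word \<theta> (map v [0..<a]) @ subst_word \<theta> (map v [a..<b])
      = map v [0..<a * p] @ map v [a * p..<b * p]"
    using prefix[of b] by (metis map_append subst_word_append)
  then show ?thesis by (simp add: prefix)
qed

lemma subst_word_funpow_block:
  assumes "\<And>n. length (\<theta> (v n)) = p" and "subst_seq p \<theta> v = v" and "a \<le> b"
  shows "(subst_word \<theta> ^^ k) (map v [a..<b]) = map v [a * p ^ k..<b * p ^ k]"
proof (induction k)
  case 0
  show ?case by simp
next
  case (Suc k)
  then show ?case
    using subst_word_block[OF assms(1,2), of "a * p ^ k" "b * p ^ k"] \<open>a \<le> b\<close>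
    by (simp add: ac_simps)
qed

lemma primitive_fixed_point_uniformly_recurrent:
  assumes "2 \<le> p" and len: "length_substitution p A \<theta>" and prim: "primitive_substitution A \<theta>"
    and A: "\<And>n. v n \<in> A" and fixpt: "subst_seq p \<theta> v = v"
  shows "\<exists>K. \<forall>q. \<exists>j. q \<le> j \<and> j \<le> q + K \<and> (\<forall>i<N. v (j + i) = v i)"
proof -
  have len': "length (\<theta> (v n)) = p" for n
    using len A by (auto simp: length_substitution_def)
  \<comment> \<open>Cutting \<open>v\<close> into consecutive blocks of length \<open>p ^ k\<close>,
    the \<open>n\<close>-th block is the \<open>k\<close>-fold image of the letter
    \<open>v n\<close>.\<close>
  have pow: "(subst_word \<theta> ^^ k) [v n] = map v [n * p ^ k..<Suc n * p ^ k]" for n k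
    using subst_word_funpow_block[OF len' fixpt, of n "Suc n" k] by simp
  obtain k where k: "\<And>a a'. a \<in> A \<Longrightarrow> a' \<in> A \<Longrightarrow> a' \<in> set ((subst_word \<theta> ^^ k) [a])"
    using prim by (auto simp: primitive_substitution_def)
  \<comment> \<open>The exponent \<open>N\<close> is chosen so that the \<open>N\<close>-fold image
    of \<open>v 0\<close> is longer than the \<open>N\<close> letters to be found again.\<close>
  have "N < 2 ^ N" by simp
  also have "\<dots> \<le> p ^ N" using \<open>2 \<le> p\<close> by (rule power_mono) simp
  finally have N: "N < p ^ N" .
  define M where "M = p ^ k * p ^ N"
  have "M > 0" using \<open>2 \<le> p\<close> by (simp add: M_def)
  have "\<exists>j. q \<le> j \<and> j \<le> q + 2 * M \<and> (\<forall>i<N. v (j + i) = v i)" for q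
  proof -
    \<comment> \<open>\<open>n * M\<close> is the first multiple of \<open>M\<close> beyond
      \<open>q\<close>. Reaching it costs at most \<open>M\<close>, and the search inside the window
      costs at most another \<open>M\<close>, whence the gap \<open>2 * M\<close>.\<close>
    define n where "n = Suc (q div M)"
    have n: "q \<le> n * M" "n * M \<le> q + M"
      using \<open>M > 0\<close> dividend_less_div_times[of M q] by (simp_all add: n_def)
    have "v 0 \<in> set (map v [n * p ^ k..<Suc n * p ^ k])"
      using k[of "v n" "v 0"] A by (simp add: pow)
    then obtain j where j: "n * p ^ k \<le> j" "j < Suc n * p ^ k" "v j = v 0"
      by (auto simp: image_iff)
    have "n * M \<le> j * p ^ N"
      using mult_le_mono1[OF j(1), of "p ^ N"] by (simp add: M_def mult.assoc)
    moreover have "j * p ^ N \<le> n * M + M"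
      using mult_le_mono1[OF less_imp_le[OF j(2)], of "p ^ N"]
      by (simp add: M_def algebra_simps)
    moreover have "v (j * p ^ N + i) = v i" if "i < N" for i
    proof -
      \<comment> \<open>The equal letters \<open>v j\<close> and \<open>v 0\<close> have equal
        \<open>N\<close>-fold images, namely the \<open>j\<close>-th and the zeroth block of length
        \<open>p ^ N\<close>.\<close>
      have "map v [j * p ^ N..<Suc j * p ^ N] = map v [0..<p ^ N]"
        using pow[of N j] pow[of N 0] j(3) by simp
      from arg_cong[OF this, of "\<lambda>w. w ! i"] show ?thesis
        using that N by simp
    qed
    ultimately show ?thesis using n by (intro exI[of _ "j * p ^ N"]) auto
  qed
  then show ?thesis by blast
qed

section \<open>Orbit closures over an inverse limit\<close>

lemma openin_inverse_limit_cylinder: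
  assumes "s \<in> inverse_limit S \<psi>"
  shows "openin (inverse_limit_topology S \<psi>) {t \<in> inverse_limit S \<psi>. t \<alpha> = s \<alpha>}"
proof -
  have "continuous_map (inverse_limit_topology S \<psi>) (discrete_topology (S \<alpha>)) (\<lambda>t. t \<alpha>)"
    unfolding inverse_limit_topology_def
    by (intro continuous_map_from_subtopology continuous_map_product_projection) simp
  moreover have "openin (discrete_topology (S \<alpha>)) {s \<alpha>}"
    using assms by (simp add: inverse_limit_def)
  ultimately have "openin (inverse_limit_topology S \<psi>)
      {t \<in> topspace (inverse_limit_topology S \<psi>). t \<alpha> \<in> {s \<alpha>}}"
    by (rule openin_continuous_map_preimage)
  then show ?thesis by simp
qed

text \<open>A basic open set restricts finitely many levels. These are linearly ordered, and a
  coordinate determines all lower ones through \<psi>, so one level above all restricted ones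
  suffices.\<close>

lemma openin_inverse_limit_contains_cylinder:
  assumes "openin (inverse_limit_topology S \<psi>) U" and "s \<in> U"
  shows "\<exists>\<alpha>. \<forall>t\<in>inverse_limit S \<psi>. t \<alpha> = s \<alpha> \<longrightarrow> t \<in> U"
proof -
  obtain V where V: "openin (product_topology (\<lambda>\<alpha>. discrete_topology (S \<alpha>)) UNIV) V"
      "U = V \<inter> inverse_limit S \<psi>"
    using assms(1) unfolding inverse_limit_topology_def openin_subtopology by blast
  obtain W where W: "finite {\<alpha>. W \<alpha> \<noteq> S \<alpha>}" "s \<in> Pi\<^sub>E UNIV W" "Pi\<^sub>E UNIV W \<subseteq> V"
    using V assms(2) by (force simp: openin_product_topology_alt)
  obtain \<alpha> where \<alpha>: "\<And>\<beta>. W \<beta> \<noteq> S \<beta> \<Longrightarrow> \<beta> \<le> \<alpha>"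
    using W(1) by (auto simp: finite_nat_set_iff_bounded_le)
  have "s \<in> inverse_limit S \<psi>" using assms(2) V(2) by blast
  have "t \<in> U" if t: "t \<in> inverse_limit S \<psi>" "t \<alpha> = s \<alpha>" for t
  proof -
    have "t \<beta> \<in> W \<beta>" for \<beta>
    proof (cases "\<beta> \<le> \<alpha>")
      case True
      then have "t \<beta> = s \<beta>"
        using t \<open>s \<in> inverse_limit S \<psi>\<close> unfolding inverse_limit_def
        by (metis (mono_tags, lifting) mem_Collect_eq)
      then show ?thesis using W(2) by auto
    next
      case False
      then have "W \<beta> = S \<beta>" using \<alpha> by blast
      then show ?thesis using t(1) by (simp add: inverse_limit_def)
    qed
    then show ?thesis using W(3) V(2) t(1) by (auto simp: PiE_UNIV_domain)
  qed
  then show ?thesis by blast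
qed

lemma funpow_shift: "(shift ^^ n) x = (\<lambda>i. x (n + i))"
  by (induction n) (simp_all add: shift_def)

lemma mem_orbit_closure_inverse_limit_iff:
  assumes x: "\<And>n. x n \<in> inverse_limit S \<psi>"
  shows "y \<in> orbit_closure (inverse_limit_topology S \<psi>) x \<longleftrightarrow>
    (\<forall>n. y n \<in> inverse_limit S \<psi>) \<and> (\<forall>\<alpha> N. \<exists>m. \<forall>i<N. y i \<alpha> = x (m + i) \<alpha>)"
    (is "?L \<longleftrightarrow> ?R1 \<and> ?R2")
proof -
  let ?T = "seq_topology (inverse_limit_topology S \<psi>)"
  have closure: "?L \<longleftrightarrow> ?R1 \<and> (\<forall>U. y \<in> U \<and> openin ?T U \<longrightarrow> (\<exists>m. (\<lambda>i. x (m + i)) \<in> U))"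
    unfolding orbit_closure_def in_closure_of topspace_seq_topology funpow_shift
      topspace_inverse_limit_topology by blast
  show ?thesis
  proof (intro iffI conjI allI)
    assume ?L
    then show y: "y n \<in> inverse_limit S \<psi>" for n using closure by blast
    fix \<alpha> N
    \<comment> \<open>The product of these sets is a basic neighbourhood of \<open>y\<close> that
      prescribes level \<open>\<alpha>\<close> of the first \<open>N\<close> letters only.\<close>
    define U where "U = (\<lambda>i. if i < N then {t \<in> inverse_limit S \<psi>. t \<alpha> = y i \<alpha>} else inverse_limit S \<psi>)"
    have "openin ?T (Pi\<^sub>E UNIV U)"
      unfolding seq_topology_def
    proof (rule product_topology_basis)
      show "openin (inverse_limit_topology S \<psi>) (U i)" for i
        using openin_inverse_limit_cylinder[OF y] openin_topspace[of "inverse_limit_topology S \<psi>"]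
        by (simp add: U_def)
      show "finite {i. U i \<noteq> topspace (inverse_limit_topology S \<psi>)}"
        by (rule finite_subset[of _ "{..<N}"]) (auto simp: U_def)
    qed
    moreover have "y \<in> Pi\<^sub>E UNIV U" using y by (auto simp: U_def PiE_UNIV_domain)
    ultimately obtain m where "(\<lambda>i. x (m + i)) \<in> Pi\<^sub>E UNIV U"
      using \<open>?L\<close> closure by blast
    then have U: "x (m + i) \<in> U i" for i by (auto simp: PiE_UNIV_domain)
    have "y i \<alpha> = x (m + i) \<alpha>" if "i < N" for i using U[of i] that by (simp add: U_def)
    then show "\<exists>m. \<forall>i<N. y i \<alpha> = x (m + i) \<alpha>" by blast
  next
    assume "?R1 \<and> ?R2"
    then have R1: ?R1 and R2: ?R2 by (rule conjunct1, rule conjunct2)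
    have "\<exists>m. (\<lambda>i. x (m + i)) \<in> V" if V: "y \<in> V" "openin ?T V" for V
    proof -
      obtain U where U: "finite {i. U i \<noteq> inverse_limit S \<psi>}"
          "\<And>i. openin (inverse_limit_topology S \<psi>) (U i)" "y \<in> Pi\<^sub>E UNIV U" "Pi\<^sub>E UNIV U \<subseteq> V"
        using V by (force simp: seq_topology_def openin_product_topology_alt)
      obtain N where N: "\<And>i. U i \<noteq> inverse_limit S \<psi> \<Longrightarrow> i < N"
        using U(1) by (auto simp: finite_nat_set_iff_bounded)
      have "\<exists>\<alpha>. \<forall>t\<in>inverse_limit S \<psi>. t \<alpha> = y i \<alpha> \<longrightarrow> t \<in> U i" for i
        using U(2,3) by (intro openin_inverse_limit_contains_cylinder) auto
      then obtain a where a: "\<And>i t. t \<in> inverse_limit S \<psi> \<Longrightarrow> t (a i) = y i (a i) \<Longrightarrow> t \<in> U i"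
        by metis
      \<comment> \<open>Each restricted position \<open>i\<close> has its own test level
        \<open>a i\<close>. A common upper bound exists because only positions below
        \<open>N\<close> are restricted, and agreement there descends to \<open>a i\<close> by
        \<psi>.\<close>
      obtain \<alpha> where \<alpha>: "\<And>i. i < N \<Longrightarrow> a i \<le> \<alpha>"
        using finite_nat_set_iff_bounded_le[of "a ` {..<N}"] by auto
      obtain m where m: "\<And>i. i < N \<Longrightarrow> y i \<alpha> = x (m + i) \<alpha>"
        using R2 by blast
      have "x (m + i) \<in> U i" for i
      proof (cases "i < N")
        case True
        have "x (m + i) (a i) = \<psi> (a i) \<alpha> (x (m + i) \<alpha>)" "y i (a i) = \<psi> (a i) \<alpha> (y i \<alpha>)"
          using x[of "m + i"] R1 \<alpha>[OF True] by (auto simp: inverse_limit_def)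
        then show ?thesis using a[OF x] m[OF True] by simp
      next
        case False
        then show ?thesis using N x by blast
      qed
      then have "(\<lambda>i. x (m + i)) \<in> Pi\<^sub>E UNIV U" by (simp add: PiE_UNIV_domain)
      then show ?thesis using U(4) by blast
    qed
    with R1 show ?L by (simp add: closure)
  qed
qed

lemma orbit_closure_inverse_limitD:
  assumes "\<And>n. x n \<in> inverse_limit S \<psi>"
    and "y \<in> orbit_closure (inverse_limit_topology S \<psi>) x"
  shows "y n \<in> inverse_limit S \<psi>" and "\<exists>m. \<forall>i<N. y i \<alpha> = x (m + i) \<alpha>"
proof -
  note y = assms(2)[unfolded mem_orbit_closure_inverse_limit_iff[where x = x, OF assms(1)]]
  show "y n \<in> inverse_limit S \<psi>" by (rule y[THEN conjunct1, THEN spec])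
  show "\<exists>m. \<forall>i<N. y i \<alpha> = x (m + i) \<alpha>" by (rule y[THEN conjunct2, THEN spec, THEN spec])
qed

text \<open>A window of a point \<open>y\<close> of the orbit closure lies in some prefix of
  \<open>u\<close> at the given level. This prefix recurs with bounded gaps, so it occurs in every
  long enough window of \<open>u\<close>, in particular in one that begins \<open>x\<close>.\<close>

lemma minimal_shift_inverse_limit:
  assumes u: "\<And>n. u n \<in> inverse_limit S \<psi>"
    and rec: "\<And>\<alpha> N. \<exists>K. \<forall>q. \<exists>j. q \<le> j \<and> j \<le> q + K \<and> (\<forall>i<N. u (j + i) \<alpha> = u i \<alpha>)"
  shows "minimal_shift (inverse_limit_topology S \<psi>) (orbit_closure (inverse_limit_topology S \<psi>) u)"
  unfolding minimal_shift_def
proof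
  fix x
  let ?X = "orbit_closure (inverse_limit_topology S \<psi>)"
  assume "x \<in> ?X u"
  note x = orbit_closure_inverse_limitD[where x = u, OF u this]
  show "?X u = ?X x"
  proof (intro equalityI subsetI)
    fix y assume "y \<in> ?X u"
    note y = orbit_closure_inverse_limitD[where x = u, OF u this]
    have "\<exists>m. \<forall>i<N. y i \<alpha> = x (m + i) \<alpha>" for \<alpha> N
    proof -
      obtain m where m: "\<forall>i<N. y i \<alpha> = u (m + i) \<alpha>"
        using y(2) by blast
      obtain K where K: "\<forall>q. \<exists>j. q \<le> j \<and> j \<le> q + K \<and> (\<forall>i<m + N. u (j + i) \<alpha> = u i \<alpha>)"
        using rec by blast
      \<comment> \<open>A copy of the prefix of length \<open>m + N\<close> starts at most
        \<open>K\<close> after \<open>q\<close>, so a window of length \<open>K + m + N\<close>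
        contains it entirely.\<close>
      obtain q where q: "\<forall>i<K + m + N. x i \<alpha> = u (q + i) \<alpha>"
        using x(2) by blast
      obtain j where j: "q \<le> j" "j \<le> q + K" "\<forall>i<m + N. u (j + i) \<alpha> = u i \<alpha>"
        using K by blast
      have "y i \<alpha> = x (j - q + m + i) \<alpha>" if "i < N" for i
      proof -
        have "x (j - q + m + i) \<alpha> = u (q + (j - q + m + i)) \<alpha>"
          using q j(1,2) that by simp
        also have "q + (j - q + m + i) = j + (m + i)" using j(1) by simp
        finally show ?thesis using j(3) m that by simp
      qed
      then show ?thesis by blast
    qed
    then show "y \<in> ?X x"
      using y(1) by (simp add: mem_orbit_closure_inverse_limit_iff[where x = x, OF x(1)])
  next
    \<comment> \<open>Conversely, a window of \<open>y\<close> lies in a prefix of \<open>x\<close>,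
      which in turn occurs in \<open>u\<close>.\<close>
    fix y assume "y \<in> ?X x"
    note y = orbit_closure_inverse_limitD[where x = x, OF x(1) this]
    have "\<exists>m. \<forall>i<N. y i \<alpha> = u (m + i) \<alpha>" for \<alpha> N
    proof -
      obtain m where m: "\<forall>i<N. y i \<alpha> = x (m + i) \<alpha>"
        using y(2) by blast
      obtain q where q: "\<forall>i<m + N. x i \<alpha> = u (q + i) \<alpha>"
        using x(2) by blast
      have "\<forall>i<N. y i \<alpha> = u (q + m + i) \<alpha>"
        using m q by (simp add: add.assoc)
      then show ?thesis by blast
    qed
    then show "y \<in> ?X u"
      using y(1) by (simp add: mem_orbit_closure_inverse_limit_iff[where x = u, OF u])
  qed
qed

text \<open>The profinite substitution acts levelwise, so projection to level
  \<open>\<alpha>\<close> commutes with it; \<open>0 < p\<close> makes \<open>m mod p\<close> a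
  valid position in the image word.\<close>

lemma subst_seq_level_subst_fixed:
  assumes "0 < p" and "subst_seq p (profinite_subst p \<delta>) u = u"
  shows "subst_seq p (level_subst p \<delta> \<alpha>) (\<lambda>n. u n \<alpha>) = (\<lambda>n. u n \<alpha>)"
proof
  fix m
  have "u m \<alpha> = (profinite_subst p \<delta> (u (m div p)) ! (m mod p)) \<alpha>"
    using fun_cong[OF assms(2), of m] by (simp add: subst_seq_def)
  then show "subst_seq p (level_subst p \<delta> \<alpha>) (\<lambda>n. u n \<alpha>) m = u m \<alpha>"
    using \<open>0 < p\<close> by (simp add: subst_seq_def profinite_subst_def)
qed

theorem proposition4p3:
  fixes p :: nat
    and S :: "nat \<Rightarrow> 's set"
    and \<delta> :: "nat \<Rightarrow> 's \<Rightarrow> nat \<Rightarrow> 's"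
    and init :: "nat \<Rightarrow> 's"
    and \<tau> :: "nat \<Rightarrow> 's \<Rightarrow> int"
    and \<psi> :: "nat \<Rightarrow> nat \<Rightarrow> 's \<Rightarrow> 's"
    and u :: "nat \<Rightarrow> (nat \<Rightarrow> 's)"
  assumes "prime p"
    and "inverse_family p S \<delta> init \<tau> \<psi>"
    and "\<And>n. u n \<in> inverse_limit S \<psi>"
    and "subst_seq p (profinite_subst p \<delta>) u = u"
    and "\<And>\<alpha>. length_substitution p (S \<alpha>) (level_subst p \<delta> \<alpha>)"
    and "\<And>\<alpha>. primitive_substitution (S \<alpha>) (level_subst p \<delta> \<alpha>)"
  shows "minimal_shift (inverse_limit_topology S \<psi>)
           (orbit_closure (inverse_limit_topology S \<psi>) u)"
proof (rule minimal_shift_inverse_limit[OF assms(3)])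
  fix \<alpha> N
  have p: "2 \<le> p" using \<open>prime p\<close> by (rule prime_ge_2_nat)
  show "\<exists>K. \<forall>q. \<exists>j. q \<le> j \<and> j \<le> q + K \<and> (\<forall>i<N. u (j + i) \<alpha> = u i \<alpha>)"
  proof (rule primitive_fixed_point_uniformly_recurrent[OF p assms(5,6)])
    show "u n \<alpha> \<in> S \<alpha>" for n using assms(3)[of n] by (simp add: inverse_limit_def)
    show "subst_seq p (level_subst p \<delta> \<alpha>) (\<lambda>n. u n \<alpha>) = (\<lambda>n. u n \<alpha>)"
      using p assms(4) by (intro subst_seq_level_subst_fixed) auto
  qed
qed

end
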